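(* For all positive integers $a\leq b$, the complete bipartite graph $K_{a,b}$ satisfies \[\tfrac{1}{2}(a+b-1)\;\leq\;\operatorname{sn}(K_{a,b})\;\leq\;\min\Big\{b,\ \big\lceil \tfrac{b}{2}\big\rceil+a-1\Big\}.\]
   Context: A (straight-line) drawing of a graph maps its vertices to distinct points in the plane and represents each edge by the closed line segment between its endpoints, such that each edge segment intersects no vertex other than its own endpoints. The slope of an edge is the angle in $[0,\pi)$ from the $x$-axis to the line containing it. The slope-number $\operatorname{sn}(G)$ is the minimum number of distinct edge slopes over all drawings of $G$. *)

theory Defs
  imports "HOL-Analysis.Analysis"
begin

text \<open>
  A graph is given by its vertex set \<open>V\<close> and its set \<open>E\<close> of edges, each edge being
  a two-element subset of \<open>V\<close>.
\<close>

definition is_drawing :: "'v set \<Rightarrow> 'v set set \<Rightarrow> ('v \<Rightarrow> real \<times> real) \<Rightarrow> bool" where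
  "is_drawing V E \<phi> \<longleftrightarrow>
     inj_on \<phi> V \<and>
     (\<forall>u v w. {u, v} \<in> E \<longrightarrow> w \<in> V \<longrightarrow>
        \<phi> w \<in> closed_segment (\<phi> u) (\<phi> v) \<longrightarrow> w = u \<or> w = v)"

definition line_angle :: "(real \<times> real) set \<Rightarrow> real" where
  "line_angle L =
     (THE \<theta>. 0 \<le> \<theta> \<and> \<theta> < pi \<and>
        (\<exists>p. L = range (\<lambda>t. p + t *\<^sub>R (cos \<theta>, sin \<theta>))))"

definition slope :: "real \<times> real \<Rightarrow> real \<times> real \<Rightarrow> real" where
  "slope p q = line_angle (affine hull {p, q})"

definition slopes :: "'v set set \<Rightarrow> ('v \<Rightarrow> real \<times> real) \<Rightarrow> real set" where
  "slopes E \<phi> = {slope (\<phi> u) (\<phi> v) | u v. {u, v} \<in> E}"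

text \<open>
  For a finite graph the set below is nonempty and all sets \<open>slopes E \<phi>\<close> are finite, so that
  this infimum of natural numbers is a minimum.
\<close>

definition slope_number :: "'v set \<Rightarrow> 'v set set \<Rightarrow> nat" where
  "slope_number V E = Inf {card (slopes E \<phi>) | \<phi>. is_drawing V E \<phi>}"

definition K_verts :: "nat \<Rightarrow> nat \<Rightarrow> (nat + nat) set" where
  "K_verts a b = {..<a} <+> {..<b}"

definition K_edges :: "nat \<Rightarrow> nat \<Rightarrow> (nat + nat) set set" where
  "K_edges a b = {{Inl i, Inr j} | i j. i < a \<and> j < b}"

text \<open>The definite description in \<open>line_angle\<close> is well defined on lines.\<close>

lemma line_angle_unique:
  fixes p q :: "real \<times> real"
  assumes "0 \<le> \<theta>" "\<theta> < pi" "0 \<le> \<theta>'" "\<theta>' < pi"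
    and eq: "range (\<lambda>t. p + t *\<^sub>R (cos \<theta>, sin \<theta>)) = range (\<lambda>t. q + t *\<^sub>R (cos \<theta>', sin \<theta>'))"
  shows "\<theta> = \<theta>'"
proof -
  have "p + 0 *\<^sub>R (cos \<theta>, sin \<theta>) \<in> range (\<lambda>t. q + t *\<^sub>R (cos \<theta>', sin \<theta>'))"
    and "p + 1 *\<^sub>R (cos \<theta>, sin \<theta>) \<in> range (\<lambda>t. q + t *\<^sub>R (cos \<theta>', sin \<theta>'))"
    unfolding eq[symmetric] by (rule rangeI)+
  then obtain s r where s: "p = q + s *\<^sub>R (cos \<theta>', sin \<theta>')"
    and r: "p + (cos \<theta>, sin \<theta>) = q + r *\<^sub>R (cos \<theta>', sin \<theta>')"
    unfolding image_iff by (metis add_0_right scaleR_one scaleR_zero_left)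
  have "(cos \<theta>, sin \<theta>) = (r - s) *\<^sub>R (cos \<theta>', sin \<theta>')"
    using s r by (simp add: prod_eq_iff algebra_simps)
  then have "sin (\<theta> - \<theta>') = 0"
    by (simp add: sin_diff)
  moreover have "\<bar>\<theta> - \<theta>'\<bar> < pi" using assms by linarith
  ultimately show ?thesis
    using sin_eq_0_pi[of "\<theta> - \<theta>'"] by (auto simp: abs_less_iff)
qed

lemma line_angle_exists:
  fixes p q :: "real \<times> real"
  assumes "p \<noteq> q"
  shows "\<exists>\<theta>. 0 \<le> \<theta> \<and> \<theta> < pi \<and> affine hull {p, q} = range (\<lambda>t. p + t *\<^sub>R (cos \<theta>, sin \<theta>))"
proof -
  obtain x y where xy: "q - p = (x, y)" by (cases "q - p")
  define z where "z = Complex x y"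
  have "z \<noteq> 0" using assms xy by (auto simp: z_def complex_eq_iff prod_eq_iff)
  define \<alpha> where "\<alpha> = Arg z"
  have \<alpha>: "-pi < \<alpha>" "\<alpha> \<le> pi" using Arg_bounded[of z] by (auto simp: \<alpha>_def)
  have z: "z = cmod z *\<^sub>R cis \<alpha>"
    using rcis_cmod_Arg[of z] by (simp add: \<alpha>_def rcis_def scaleR_conv_of_real)
  define \<theta> where "\<theta> = (if \<alpha> < 0 then \<alpha> + pi else if \<alpha> = pi then 0 else \<alpha>)"
  define c where "c = (if \<alpha> < 0 \<or> \<alpha> = pi then - cmod z else cmod z)"
  have "z = c *\<^sub>R cis \<theta>"
    by (subst z) (auto simp: c_def \<theta>_def complex_eq_iff)
  then have c: "q - p = c *\<^sub>R (cos \<theta>, sin \<theta>)"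
    using xy by (simp add: z_def complex_eq_iff)
  have "c \<noteq> 0" using \<open>z \<noteq> 0\<close> by (simp add: c_def)
  have \<theta>: "0 \<le> \<theta>" "\<theta> < pi" using \<alpha> by (auto simp: \<theta>_def)
  have "affine hull {p, q} = range (\<lambda>t. p + t *\<^sub>R (q - p))"
    by (auto simp: affine_hull_2_alt)
  also have "\<dots> = range (\<lambda>t. p + t *\<^sub>R (cos \<theta>, sin \<theta>))"
  proof (intro equalityI subsetI)
    fix w assume "w \<in> range (\<lambda>t. p + t *\<^sub>R (q - p))"
    then obtain t where "w = p + t *\<^sub>R (q - p)" by blast
    then have "w = p + (t * c) *\<^sub>R (cos \<theta>, sin \<theta>)" by (simp add: c)
    then show "w \<in> range (\<lambda>t. p + t *\<^sub>R (cos \<theta>, sin \<theta>))" by blast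
  next
    fix w assume "w \<in> range (\<lambda>t. p + t *\<^sub>R (cos \<theta>, sin \<theta>))"
    then obtain t where "w = p + t *\<^sub>R (cos \<theta>, sin \<theta>)" by blast
    then have "w = p + (t / c) *\<^sub>R (q - p)" using \<open>c \<noteq> 0\<close> by (simp add: c)
    then show "w \<in> range (\<lambda>t. p + t *\<^sub>R (q - p))" by blast
  qed
  finally show ?thesis using \<theta> by blast
qed

end

theory Submission
  imports Defs
begin

text \<open>
  Lower bound. If a finite set \<open>P\<close> lies to the left of a finite set \<open>Q\<close> and no segment between
  them contains a third point, then the segment of least gradient is the only one of that gradient;
  deleting one of its endpoints and inducting yields at least \<open>|P| + |Q| - 1\<close> slopes.
  Shear the plane so that all vertices have distinct abscissae, let \<open>A\<close> be the class not containing
  the leftmost vertex, and let \<open>v\<close> be the leftmost vertex of \<open>A\<close>. If \<open>l > 0\<close> and \<open>r\<close> vertices of the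
  other class lie to the left and to the right of \<open>v\<close>, there are at least \<open>r\<close> slopes at \<open>v\<close> and at
  least \<open>l + |A| - 1\<close> slopes between the \<open>l\<close> vertices and \<open>A\<close>; add the two bounds.

  Upper bounds. Alternating the two classes around a regular \<open>2b\<close>-gon gives \<open>b\<close> slopes. Placing
  the first class on a vertical line and the two halves of the second class on parallel lines at
  distance one on either side, all at integer heights, gives the other bound.
\<close>

section \<open>Slopes\<close>

lemma affine_hull_2_eq_range:
  fixes p q v :: "'a::real_vector"
  assumes "c \<noteq> 0" and "q - p = c *\<^sub>R v"
  shows "affine hull {p, q} = range (\<lambda>t. p + t *\<^sub>R v)"
proof -
  have "affine hull {p, q} = (\<lambda>t. p + t *\<^sub>R v) ` range (\<lambda>t. t * c)"
    using assms(2) by (auto simp: affine_hull_2_alt)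
  also have "range (\<lambda>t. t * c) = UNIV"
    using assms(1) by (intro surjI[of _ "\<lambda>t. t / c"]) simp
  finally show ?thesis .
qed

lemma slope_eqI:
  assumes bounds: "0 \<le> \<theta>" "\<theta> < pi" and direction: "c \<noteq> 0" "q - p = c *\<^sub>R (cos \<theta>, sin \<theta>)"
  shows "slope p q = \<theta>"
  unfolding slope_def line_angle_def affine_hull_2_eq_range[OF direction]
proof (rule the_equality)
  show "0 \<le> \<theta> \<and> \<theta> < pi \<and>
      (\<exists>x. range (\<lambda>t. p + t *\<^sub>R (cos \<theta>, sin \<theta>)) = range (\<lambda>t. x + t *\<^sub>R (cos \<theta>, sin \<theta>)))"
    using bounds by blast
  show "\<eta> = \<theta>" if "0 \<le> \<eta> \<and> \<eta> < pi \<and>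
      (\<exists>x. range (\<lambda>t. p + t *\<^sub>R (cos \<theta>, sin \<theta>)) = range (\<lambda>t. x + t *\<^sub>R (cos \<eta>, sin \<eta>)))" for \<eta>
    using that bounds line_angle_unique by metis
qed

lemma slope_direction:
  assumes "p \<noteq> q"
  obtains c where "c \<noteq> 0" "q - p = c *\<^sub>R (cos (slope p q), sin (slope p q))"
    "0 \<le> slope p q" "slope p q < pi"
proof -
  obtain \<theta> where \<theta>: "0 \<le> \<theta>" "\<theta> < pi"
      "affine hull {p, q} = range (\<lambda>t. p + t *\<^sub>R (cos \<theta>, sin \<theta>))"
    using line_angle_exists[OF assms] by blast
  have "q \<in> affine hull {p, q}" by (simp add: hull_inc)
  then obtain c where "q = p + c *\<^sub>R (cos \<theta>, sin \<theta>)" using \<theta> by blast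
  then have direction: "q - p = c *\<^sub>R (cos \<theta>, sin \<theta>)" by simp
  then have "c \<noteq> 0" using assms by (metis right_minus_eq scaleR_zero_left)
  with direction \<theta> slope_eqI that show thesis by metis
qed

lemma slope_commute: "slope p q = slope q p"
  by (simp add: slope_def insert_commute)

lemma slope_parallel:
  assumes "p \<noteq> q" "d \<noteq> 0" "s - r = d *\<^sub>R (q - p)"
  shows "slope r s = slope p q"
proof -
  obtain c where direction: "c \<noteq> 0" "q - p = c *\<^sub>R (cos (slope p q), sin (slope p q))"
      "0 \<le> slope p q" "slope p q < pi"
    using slope_direction[OF assms(1)] .
  have "s - r = (d * c) *\<^sub>R (cos (slope p q), sin (slope p q))"
    using assms(3) direction(2) by (metis scaleR_scaleR)
  moreover have "d * c \<noteq> 0" using direction(1) assms(2) by simp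
  ultimately show ?thesis
    using slope_eqI[OF direction(3,4)] by blast
qed

lemma slope_linear_image:
  fixes T :: "real \<times> real \<Rightarrow> real \<times> real"
  assumes "linear T" "inj T" "p \<noteq> q"
  shows "slope (T p) (T q) = slope 0 (T (cos (slope p q), sin (slope p q)))"
proof -
  obtain c where "c \<noteq> 0" and direction: "q - p = c *\<^sub>R (cos (slope p q), sin (slope p q))"
    using slope_direction[OF assms(3)] .
  have image_direction: "T q - T p = c *\<^sub>R T (cos (slope p q), sin (slope p q))"
    using assms(1) direction by (metis linear_diff linear_cmul)
  moreover have "T q \<noteq> T p" using assms(2,3) by (simp add: inj_eq)
  ultimately have "T (cos (slope p q), sin (slope p q)) \<noteq> 0" by auto
  with \<open>c \<noteq> 0\<close> image_direction show ?thesis by (intro slope_parallel[of _ _ c]) simp_all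
qed

text \<open>Vertical segments are covered as well: both sides are then \<open>x / 0 = 0\<close>.\<close>

lemma tan_slope:
  assumes "p \<noteq> q"
  shows "tan (slope p q) = (snd q - snd p) / (fst q - fst p)"
proof -
  obtain c where "c \<noteq> 0" and direction: "q - p = c *\<^sub>R (cos (slope p q), sin (slope p q))"
    using slope_direction[OF assms] .
  have "fst q - fst p = c * cos (slope p q)" "snd q - snd p = c * sin (slope p q)"
    using arg_cong[OF direction, of fst] arg_cong[OF direction, of snd] by simp_all
  with \<open>c \<noteq> 0\<close> show ?thesis by (simp add: tan_def)
qed

definition slopes_between :: "(real \<times> real) set \<Rightarrow> (real \<times> real) set \<Rightarrow> real set" where
  "slopes_between A B = {slope p q | p q. p \<in> A \<and> q \<in> B}"

lemma finite_slopes_between: "finite A \<Longrightarrow> finite B \<Longrightarrow> finite (slopes_between A B)"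
  unfolding slopes_between_def by (rule finite_image_set2) simp_all

lemma slopes_between_mono:
  "A \<subseteq> A' \<Longrightarrow> B \<subseteq> B' \<Longrightarrow> slopes_between A B \<subseteq> slopes_between A' B'"
  unfolding slopes_between_def by blast

lemma slopes_between_commute: "slopes_between A B = slopes_between B A"
  unfolding slopes_between_def using slope_commute by blast

lemma card_slopes_between_linear_image:
  fixes T :: "real \<times> real \<Rightarrow> real \<times> real"
  assumes "finite A" "finite B" "A \<inter> B = {}" "linear T" "inj T"
  shows "card (slopes_between (T ` A) (T ` B)) \<le> card (slopes_between A B)"
proof -
  let ?g = "\<lambda>\<theta>. slope 0 (T (cos \<theta>, sin \<theta>))"
  have "slope (T p) (T q) = ?g (slope p q)" if "p \<in> A" "q \<in> B" for p q
    using that assms(3) by (intro slope_linear_image[OF assms(4,5)]) auto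
  then have "slopes_between (T ` A) (T ` B) \<subseteq> ?g ` slopes_between A B"
    unfolding slopes_between_def by blast
  then show ?thesis
    by (intro surj_card_le finite_slopes_between assms)
qed

section \<open>Drawings of complete bipartite graphs\<close>

definition unobstructed :: "'a::real_vector set \<Rightarrow> 'a set \<Rightarrow> bool" where
  "unobstructed A B \<longleftrightarrow> (\<forall>p\<in>A. \<forall>q\<in>B. closed_segment p q \<inter> (A \<union> B) = {p, q})"

lemma unobstructedI:
  assumes "\<And>p q w. p \<in> A \<Longrightarrow> q \<in> B \<Longrightarrow> w \<in> A \<union> B \<Longrightarrow> w \<in> closed_segment p q \<Longrightarrow> w = p \<or> w = q"
  shows "unobstructed A B"
  unfolding unobstructed_def using assms by auto

lemma unobstructedD:
  assumes "unobstructed A B" "p \<in> A" "q \<in> B" "w \<in> A \<union> B" "w \<in> closed_segment p q"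
  shows "w = p \<or> w = q"
  using assms unfolding unobstructed_def by blast

lemma unobstructed_sym:
  assumes "unobstructed A B"
  shows "unobstructed B A"
  by (rule unobstructedI) (use unobstructedD[OF assms] closed_segment_commute in blast)

lemma unobstructed_subset:
  assumes "unobstructed A B" "A' \<subseteq> A" "B' \<subseteq> B"
  shows "unobstructed A' B'"
  by (rule unobstructedI) (use unobstructedD[OF assms(1)] assms(2,3) in blast)

lemma unobstructed_linear_image:
  assumes "unobstructed A B" "linear T" "inj T"
  shows "unobstructed (T ` A) (T ` B)"
  using assms unfolding unobstructed_def
  by (simp add: closed_segment_linear_image image_Un[symmetric] image_Int[symmetric])

lemma unobstructed_ray_unique:
  assumes unobstructed: "unobstructed A B" and "u \<in> A" "v \<in> B" "w \<in> B"
    and "d > 0" "v - u = d *\<^sub>R (w - u)"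
  shows "v = w"
proof -
  have nearer: "v = w"
    if "v \<in> B" "w \<in> B" "0 < d" "d \<le> 1" and parallel: "v - u = d *\<^sub>R (w - u)" for v w d
  proof -
    have "v = (1 - d) *\<^sub>R u + d *\<^sub>R w" using parallel by (simp add: algebra_simps)
    then have "v \<in> closed_segment u w" using that by (auto simp: closed_segment_def)
    then have "v = u \<or> v = w" using unobstructedD[OF unobstructed \<open>u \<in> A\<close>] that by blast
    then show ?thesis using parallel \<open>0 < d\<close> by auto
  qed
  show ?thesis
  proof (cases "d \<le> 1")
    case True
    then show ?thesis using nearer assms by blast
  next
    case False
    have "w - u = (1 / d) *\<^sub>R (v - u)" using assms(5,6) by simp
    then show ?thesis using nearer[of w v "1 / d"] assms False by simp
  qed
qed

lemma K_verts_eq: "K_verts a b = Inl ` {..<a} \<union> Inr ` {..<b}"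
  by (auto simp: K_verts_def)

lemma K_edge_iff:
  "{u, v} \<in> K_edges a b \<longleftrightarrow>
     u \<in> Inl ` {..<a} \<and> v \<in> Inr ` {..<b} \<or> u \<in> Inr ` {..<b} \<and> v \<in> Inl ` {..<a}"
  unfolding K_edges_def by (auto simp: doubleton_eq_iff)

lemma is_drawing_K_iff:
  "is_drawing (K_verts a b) (K_edges a b) \<phi> \<longleftrightarrow>
     inj_on \<phi> (K_verts a b) \<and> unobstructed (\<phi> ` Inl ` {..<a}) (\<phi> ` Inr ` {..<b})"
    (is "_ \<longleftrightarrow> _ \<and> unobstructed (\<phi> ` ?A) (\<phi> ` ?B)")
proof (intro iffI conjI)
  assume drawing: "is_drawing (K_verts a b) (K_edges a b) \<phi>"
  then show "inj_on \<phi> (K_verts a b)" by (simp add: is_drawing_def)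
  have avoids: "w = u \<or> w = v"
      if "{u, v} \<in> K_edges a b" "w \<in> K_verts a b" "\<phi> w \<in> closed_segment (\<phi> u) (\<phi> v)"
      for u v w
    using drawing that by (auto simp: is_drawing_def)
  show "unobstructed (\<phi> ` ?A) (\<phi> ` ?B)"
  proof (rule unobstructedI)
    fix p q x
    assume "p \<in> \<phi> ` ?A" "q \<in> \<phi> ` ?B" "x \<in> \<phi> ` ?A \<union> \<phi> ` ?B"
      and on_segment: "x \<in> closed_segment p q"
    then obtain u v w where preimages: "u \<in> ?A" "v \<in> ?B" "w \<in> ?A \<union> ?B"
      "p = \<phi> u" "q = \<phi> v" "x = \<phi> w"
      by blast
    then have "w = u \<or> w = v"
      using avoids on_segment unfolding K_edge_iff K_verts_eq by blast
    then show "x = p \<or> x = q" using preimages by blast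
  qed
next
  assume "inj_on \<phi> (K_verts a b) \<and> unobstructed (\<phi> ` ?A) (\<phi> ` ?B)"
  then have inj: "inj_on \<phi> (K_verts a b)"
    and unobstructed: "unobstructed (\<phi> ` ?A) (\<phi> ` ?B)" by simp_all
  have "w = u \<or> w = v"
    if edge: "{u, v} \<in> K_edges a b" and obstacle: "w \<in> K_verts a b" "\<phi> w \<in> closed_segment (\<phi> u) (\<phi> v)"
    for u v w
  proof -
    have "\<phi> w = \<phi> u \<or> \<phi> w = \<phi> v"
      using edge obstacle unobstructedD[OF unobstructed] closed_segment_commute
      unfolding K_edge_iff K_verts_eq by blast
    moreover have "u \<in> K_verts a b" "v \<in> K_verts a b" using edge by (auto simp: K_edge_iff K_verts_eq)
    ultimately show ?thesis using inj obstacle(1) by (auto dest: inj_onD)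
  qed
  with inj show "is_drawing (K_verts a b) (K_edges a b) \<phi>" by (simp add: is_drawing_def)
qed

lemma slopes_K_edges:
  "slopes (K_edges a b) \<phi> = slopes_between (\<phi> ` Inl ` {..<a}) (\<phi> ` Inr ` {..<b})"
    (is "_ = slopes_between (\<phi> ` ?A) (\<phi> ` ?B)")
proof (intro equalityI subsetI)
  fix s assume "s \<in> slopes (K_edges a b) \<phi>"
  then obtain u v where "{u, v} \<in> K_edges a b" and s_eq: "s = slope (\<phi> u) (\<phi> v)"
    by (auto simp: slopes_def)
  then have "u \<in> ?A \<and> v \<in> ?B \<or> v \<in> ?A \<and> u \<in> ?B" by (auto simp: K_edge_iff)
  then show "s \<in> slopes_between (\<phi> ` ?A) (\<phi> ` ?B)"
    using s_eq slope_commute unfolding slopes_between_def by blast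
qed (force simp: slopes_def slopes_between_def K_edge_iff)

lemma slope_number_le:
  assumes "is_drawing V E \<phi>"
  shows "slope_number V E \<le> card (slopes E \<phi>)"
  unfolding slope_number_def by (rule cInf_lower) (use assms in auto)

lemma slope_number_attained:
  assumes "is_drawing V E \<phi>"
  obtains \<psi> where "is_drawing V E \<psi>" "slope_number V E = card (slopes E \<psi>)"
proof -
  have "slope_number V E \<in> {card (slopes E \<phi>) | \<phi>. is_drawing V E \<phi>}"
    unfolding slope_number_def by (rule Inf_nat_def1) (use assms in auto)
  then show thesis using that by blast
qed

section \<open>The lower bound\<close>

lemma unobstructed_line_unique:
  fixes A B :: "(real \<times> real) set"
  assumes "unobstructed A B" "u \<in> A" "v \<in> B" "w \<in> B"
    and on_line: "snd v - snd u = m * (fst v - fst u)" "snd w - snd u = m * (fst w - fst u)"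
    and same_side: "0 < (fst v - fst u) / (fst w - fst u)"
  shows "v = w"
  using assms(1-4) same_side
proof (rule unobstructed_ray_unique)
  have "fst w \<noteq> fst u" using same_side by auto
  then show "v - u = ((fst v - fst u) / (fst w - fst u)) *\<^sub>R (w - u)"
    using on_line by (simp add: prod_eq_iff)
qed

lemma minimal_tan_slope_unique:
  assumes unobstructed: "unobstructed P Q" and separated: "\<And>p q. p \<in> P \<Longrightarrow> q \<in> Q \<Longrightarrow> fst p < fst q"
    and in_PQ: "p \<in> P" "q \<in> Q" "p' \<in> P" "q' \<in> Q"
    and minimal: "\<And>r s. r \<in> P \<Longrightarrow> s \<in> Q \<Longrightarrow> tan (slope p q) \<le> tan (slope r s)"
    and same_slope: "slope p' q' = slope p q"
  shows "p' = p \<and> q' = q"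
proof -
  define m where "m = tan (slope p q)"
  define h where "h r = snd r - m * fst r" for r :: "real \<times> real"
  have tan_eq: "tan (slope r s) = (snd s - snd r) / (fst s - fst r)" if "r \<in> P" "s \<in> Q" for r s
    using separated[OF that] by (intro tan_slope) auto
  have h_le: "h r \<le> h s" if "r \<in> P" "s \<in> Q" for r s
    using minimal[OF that] separated[OF that] tan_eq[OF that]
    by (simp add: h_def m_def[symmetric] field_simps)
  have h_eq: "h r = h s" if "r \<in> P" "s \<in> Q" "slope r s = slope p q" for r s
    using that(3) separated[OF that(1,2)] tan_eq[OF that(1,2)]
    by (simp add: h_def m_def field_simps)
  have "h p = h q" "h p' = h q'" "h p \<le> h q'" "h p' \<le> h q"
    using in_PQ same_slope by (auto intro: h_eq h_le)
  then have "h q' = h q" "h p' = h q" "h p = h q" by linarith+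
  then have on_line: "snd q' - snd p = m * (fst q' - fst p)" "snd q - snd p = m * (fst q - fst p)"
      "snd p' - snd q = m * (fst p' - fst q)" "snd p - snd q = m * (fst p - fst q)"
    by (simp_all add: h_def algebra_simps)
  have "q' = q"
    using unobstructed in_PQ(1,4,2) on_line(1,2)
    by (rule unobstructed_line_unique) (use separated in_PQ in \<open>simp add: divide_pos_pos\<close>)
  moreover have "p' = p"
    using unobstructed_sym[OF unobstructed] in_PQ(2,3,1) on_line(3,4)
    by (rule unobstructed_line_unique) (use separated in_PQ in \<open>simp add: divide_neg_neg\<close>)
  ultimately show ?thesis by blast
qed

lemma separated_unique_slope:
  assumes "finite P" "finite Q" "P \<noteq> {}" "Q \<noteq> {}" and unobstructed: "unobstructed P Q"
    and separated: "\<And>p q. p \<in> P \<Longrightarrow> q \<in> Q \<Longrightarrow> fst p < fst q"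
  obtains p q where "p \<in> P" "q \<in> Q"
    "\<forall>p'\<in>P. \<forall>q'\<in>Q. slope p' q' = slope p q \<longrightarrow> p' = p \<and> q' = q"
proof -
  define f where "f e = tan (slope (fst e) (snd e))" for e
  have "finite (P \<times> Q)" "P \<times> Q \<noteq> {}" using assms(1-4) by auto
  then obtain e where e_minimal: "e \<in> P \<times> Q" "\<And>e'. e' \<in> P \<times> Q \<Longrightarrow> f e \<le> f e'"
    using ex_is_arg_min_if_finite[of "P \<times> Q" f] unfolding is_arg_min_linorder by blast
  obtain p q where e_eq: "e = (p, q)" by (cases e)
  with e_minimal(1) have endpoints: "p \<in> P" "q \<in> Q" by simp_all
  have minimal: "tan (slope p q) \<le> tan (slope r s)" if "r \<in> P" "s \<in> Q" for r s
    using e_minimal(2)[of "(r, s)"] that by (simp add: f_def e_eq)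
  show thesis
    using minimal_tan_slope_unique[OF unobstructed separated endpoints _ _ minimal]
    by (intro that[OF endpoints]) blast
qed

lemma card_slopes_between_less:
  assumes "finite P" "finite Q" "p \<in> P" "q \<in> Q"
    and unique: "\<forall>p'\<in>P. \<forall>q'\<in>Q. slope p' q' = slope p q \<longrightarrow> p' = p \<and> q' = q"
    and subsets: "P' \<subseteq> P" "Q' \<subseteq> Q" and removed: "p \<notin> P' \<or> q \<notin> Q'"
  shows "card (slopes_between P' Q') < card (slopes_between P Q)"
proof (rule psubset_card_mono)
  show "finite (slopes_between P Q)" using assms(1,2) by (rule finite_slopes_between)
  have "slope p q \<in> slopes_between P Q"
    using assms(3,4) unfolding slopes_between_def by blast
  moreover have "slope p q \<notin> slopes_between P' Q'"
  proof
    assume "slope p q \<in> slopes_between P' Q'"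
    then obtain r s where "r \<in> P'" "s \<in> Q'" "slope r s = slope p q"
      unfolding slopes_between_def by auto
    then show False using unique subsets removed by blast
  qed
  ultimately show "slopes_between P' Q' \<subset> slopes_between P Q"
    using slopes_between_mono[OF subsets] by blast
qed

lemma obtain_endpoint_deletion:
  assumes "finite P" "finite Q" "p \<in> P" "q \<in> Q" "\<not> (P = {p} \<and> Q = {q})"
  obtains P' Q' where "P' \<subseteq> P" "Q' \<subseteq> Q" "P' \<noteq> {}" "Q' \<noteq> {}" "p \<notin> P' \<or> q \<notin> Q'"
    "card P + card Q = Suc (card P' + card Q')"
proof (cases "P = {p}")
  case True
  then have "Q - {q} \<noteq> {}" using assms by blast
  then show thesis
    using that[of P "Q - {q}"] card.remove[OF assms(2,4)] assms(3) by auto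
next
  case False
  then have "P - {p} \<noteq> {}" using assms by blast
  then show thesis
    using that[of "P - {p}" Q] card.remove[OF assms(1,3)] assms(4) by auto
qed

lemma card_slopes_between_separated:
  assumes "finite P" "finite Q" "P \<noteq> {}" "Q \<noteq> {}" "unobstructed P Q"
    and "\<And>p q. p \<in> P \<Longrightarrow> q \<in> Q \<Longrightarrow> fst p < fst q"
  shows "card P + card Q \<le> Suc (card (slopes_between P Q))"
  using assms
proof (induction "card P + card Q" arbitrary: P Q rule: less_induct)
  case less
  obtain p q where endpoints: "p \<in> P" "q \<in> Q"
    and unique: "\<forall>p'\<in>P. \<forall>q'\<in>Q. slope p' q' = slope p q \<longrightarrow> p' = p \<and> q' = q"
    using separated_unique_slope[OF less.prems] .
  show ?case
  proof (cases "P = {p} \<and> Q = {q}")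
    case True
    moreover have "slopes_between {p} {q} = {slope p q}" unfolding slopes_between_def by blast
    ultimately show ?thesis by simp
  next
    case False
    then obtain P' Q' where subsets: "P' \<subseteq> P" "Q' \<subseteq> Q" and nonempty: "P' \<noteq> {}" "Q' \<noteq> {}"
      and removed: "p \<notin> P' \<or> q \<notin> Q'" and cards: "card P + card Q = Suc (card P' + card Q')"
      using obtain_endpoint_deletion[OF less.prems(1,2) endpoints] by metis
    have "card P' + card Q' \<le> Suc (card (slopes_between P' Q'))"
    proof (rule less.hyps)
      show "finite P'" "finite Q'" using less.prems(1,2) subsets finite_subset by blast+
      show "unobstructed P' Q'" using less.prems(5) subsets by (rule unobstructed_subset)
      show "fst r < fst s" if "r \<in> P'" "s \<in> Q'" for r s
        using less.prems(6) that subsets by blast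
    qed (use cards nonempty in simp_all)
    moreover have "card (slopes_between P' Q') < card (slopes_between P Q)"
      using less.prems(1,2) endpoints unique subsets removed by (rule card_slopes_between_less)
    ultimately show ?thesis using cards by linarith
  qed
qed

lemma card_slopes_between_leftmost:
  assumes fin: "finite A" "finite B" and "A \<noteq> {}" and unobstructed: "unobstructed A B"
    and disjoint: "A \<inter> B = {}" and inj: "inj_on fst (A \<union> B)"
    and leftmost: "u \<in> B" "\<And>p. p \<in> A \<Longrightarrow> fst u \<le> fst p"
  shows "card A + card B \<le> Suc (2 * card (slopes_between A B))"
proof -
  obtain v where v_leftmost: "v \<in> A" "\<And>p. p \<in> A \<Longrightarrow> fst v \<le> fst p"
    using ex_is_arg_min_if_finite[OF fin(1) \<open>A \<noteq> {}\<close>, of fst]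
    unfolding is_arg_min_linorder by blast
  define L where "L = {q \<in> B. fst q < fst v}"
  define R where "R = {q \<in> B. fst v < fst q}"
  have finite_LR: "finite L" "finite R" using fin by (simp_all add: L_def R_def)
  have abscissa_neq: "fst q \<noteq> fst v" if "q \<in> B" for q
    using inj_onD[OF inj, of q v] v_leftmost(1) disjoint that by blast
  then have "B = L \<union> R" "L \<inter> R = {}" by (fastforce simp: L_def R_def)+
  then have card_B: "card B = card L + card R" using card_Un_disjoint finite_LR by blast
  have "card L + card A \<le> Suc (card (slopes_between L A))"
  proof (rule card_slopes_between_separated)
    have "u \<in> L" using leftmost(1) leftmost(2)[OF v_leftmost(1)] abscissa_neq[OF leftmost(1)]
      by (simp add: L_def)
    then show "L \<noteq> {}" by blast
    show "unobstructed L A"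
      using unobstructed_sym[OF unobstructed] by (rule unobstructed_subset) (auto simp: L_def)
    show "fst p < fst q" if "p \<in> L" "q \<in> A" for p q
      using that v_leftmost(2)[of q] by (simp add: L_def)
  qed (use fin finite_LR \<open>A \<noteq> {}\<close> in auto)
  moreover have "card R \<le> card (slopes_between {v} R)"
  proof (cases "R = {}")
    case False
    have "unobstructed {v} R"
      by (rule unobstructed_subset[OF unobstructed]) (use v_leftmost(1) in \<open>auto simp: R_def\<close>)
    then have "card {v} + card R \<le> Suc (card (slopes_between {v} R))"
      using False finite_LR by (intro card_slopes_between_separated) (auto simp: R_def)
    then show ?thesis by simp
  qed simp
  moreover have "card (slopes_between L A) \<le> card (slopes_between A B)"
      "card (slopes_between {v} R) \<le> card (slopes_between A B)"
    unfolding slopes_between_commute[of L A] using v_leftmost(1)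
    by (intro card_mono finite_slopes_between slopes_between_mono fin; auto simp: L_def R_def)+
  ultimately show ?thesis using card_B by linarith
qed

lemma ex_inj_on_shear:
  fixes P :: "(real \<times> real) set"
  assumes "finite P"
  obtains c where "inj_on (\<lambda>p. fst p + c * snd p) P"
proof -
  let ?bad = "(\<lambda>(p, q). - (fst p - fst q) / (snd p - snd q)) ` (P \<times> P)"
  have "finite ?bad" using assms by simp
  then obtain c where not_bad: "c \<notin> ?bad"
    using ex_new_if_finite[OF infinite_UNIV_char_0] by blast
  have "inj_on (\<lambda>p. fst p + c * snd p) P"
  proof (rule inj_onI)
    fix p q assume same_image: "p \<in> P" "q \<in> P" "fst p + c * snd p = fst q + c * snd q"
    have "snd p = snd q"
    proof (rule ccontr)
      assume "snd p \<noteq> snd q"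
      then have "c = - (fst p - fst q) / (snd p - snd q)"
        using same_image(3) by (simp add: field_simps)
      with not_bad same_image show False by (force simp: image_iff)
    qed
    with same_image(3) show "p = q" by (simp add: prod_eq_iff)
  qed
  with that show thesis .
qed

lemma card_slopes_between_distinct_abscissae:
  assumes fin: "finite A" "finite B" and nonempty: "A \<noteq> {}" "B \<noteq> {}"
    and unobstructed: "unobstructed A B" and disjoint: "A \<inter> B = {}" and inj: "inj_on fst (A \<union> B)"
  shows "card A + card B \<le> Suc (2 * card (slopes_between A B))"
proof -
  have "finite (A \<union> B)" "A \<union> B \<noteq> {}" using fin nonempty by auto
  then obtain u where u_leftmost: "u \<in> A \<union> B" "\<And>p. p \<in> A \<union> B \<Longrightarrow> fst u \<le> fst p"
    using ex_is_arg_min_if_finite[of "A \<union> B" fst] unfolding is_arg_min_linorder by blast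
  then consider (A) "u \<in> A" | (B) "u \<in> B" by blast
  then show ?thesis
  proof cases
    case A
    have "card B + card A \<le> Suc (2 * card (slopes_between B A))"
      by (rule card_slopes_between_leftmost[OF fin(2,1) nonempty(2) unobstructed_sym[OF unobstructed]
            _ _ A])
        (use disjoint inj u_leftmost in \<open>auto simp: Un_commute\<close>)
    then show ?thesis by (simp add: slopes_between_commute[of B])
  next
    case B
    show ?thesis
      by (rule card_slopes_between_leftmost[OF fin nonempty(1) unobstructed disjoint inj B])
        (use u_leftmost in blast)
  qed
qed

lemma card_slopes_between_ge:
  assumes fin: "finite A" "finite B" and nonempty: "A \<noteq> {}" "B \<noteq> {}"
    and unobstructed: "unobstructed A B" and disjoint: "A \<inter> B = {}"
  shows "card A + card B \<le> Suc (2 * card (slopes_between A B))"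
proof -
  obtain c where inj_sheared: "inj_on (\<lambda>p. fst p + c * snd p) (A \<union> B)"
    using ex_inj_on_shear fin by (metis finite_Un)
  define T where "T p = (fst p + c * snd p, snd p)" for p
  have linear: "linear T" by (rule linearI) (auto simp: T_def algebra_simps)
  have inj: "inj T" by (auto simp: inj_def T_def prod_eq_iff)
  have "card (T ` A) + card (T ` B) \<le> Suc (2 * card (slopes_between (T ` A) (T ` B)))"
  proof (rule card_slopes_between_distinct_abscissae)
    show "unobstructed (T ` A) (T ` B)" using unobstructed linear inj by (rule unobstructed_linear_image)
    show "T ` A \<inter> T ` B = {}" using disjoint inj by (simp flip: image_Int)
    show "inj_on fst (T ` A \<union> T ` B)"
      using inj_sheared by (simp add: T_def comp_def inj_on_imageI flip: image_Un)
  qed (use fin nonempty in auto)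
  moreover have "card (T ` A) = card A" "card (T ` B) = card B"
    using inj by (auto intro!: card_image inj_on_subset[OF inj])
  ultimately show ?thesis
    using card_slopes_between_linear_image[OF fin disjoint linear inj] by linarith
qed

lemma card_slopes_K_ge:
  assumes "1 \<le> a" "1 \<le> b" and drawing: "is_drawing (K_verts a b) (K_edges a b) \<phi>"
  shows "a + b \<le> Suc (2 * card (slopes (K_edges a b) \<phi>))"
proof -
  let ?A = "Inl ` {..<a} :: (nat + nat) set" and ?B = "Inr ` {..<b} :: (nat + nat) set"
  have inj: "inj_on \<phi> (?A \<union> ?B)" and unobstructed: "unobstructed (\<phi> ` ?A) (\<phi> ` ?B)"
    using drawing unfolding is_drawing_K_iff by (simp_all add: K_verts_eq)
  have "\<phi> ` ?A \<inter> \<phi> ` ?B = {}"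
    using inj_on_image_Int[OF inj, of ?A ?B] by auto
  then have "card (\<phi> ` ?A) + card (\<phi> ` ?B) \<le> Suc (2 * card (slopes (K_edges a b) \<phi>))"
    unfolding slopes_K_edges using assms(1,2) unobstructed
    by (intro card_slopes_between_ge) (auto simp: lessThan_empty_iff)
  moreover have "card (\<phi> ` ?A) = a" "card (\<phi> ` ?B) = b"
    using inj by (simp_all add: inj_on_Un card_image)
  ultimately show ?thesis by simp
qed

section \<open>The upper bounds\<close>

definition polygon_point :: "nat \<Rightarrow> nat \<Rightarrow> real \<times> real" where
  "polygon_point n k = (cos (2 * pi * k / n), sin (2 * pi * k / n))"

lemma norm_polygon_point: "norm (polygon_point n k) = 1"
  by (simp add: polygon_point_def norm_Pair)

lemma inj_on_polygon_point: "inj_on (polygon_point n) {..<n}"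
proof (rule inj_onI)
  fix j k assume jk: "j \<in> {..<n}" "k \<in> {..<n}" and "polygon_point n j = polygon_point n k"
  then have "sin (2 * pi * j / n) = sin (2 * pi * k / n) \<and>
      cos (2 * pi * j / n) = cos (2 * pi * k / n)"
    by (simp add: polygon_point_def)
  then obtain z :: int where "2 * pi * j / n = 2 * pi * k / n + 2 * pi * z"
    using sin_cos_eq_iff by blast
  then have "2 * pi * real j = 2 * pi * (real k + real n * z)"
    using jk(1) by (simp add: field_simps)
  then have "real_of_int (int j) = real_of_int (int k + int n * z)" by simp
  then have "int j = int k + int n * z" by (simp only: of_int_eq_iff)
  then have "int j mod int n = int k mod int n" by simp
  then show "j = k" using jk by simp
qed

definition chord_direction :: "nat \<Rightarrow> nat \<Rightarrow> real \<times> real" where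
  "chord_direction n s = (- sin (pi * s / n), cos (pi * s / n))"

lemma chord_direction_neq_0: "chord_direction n s \<noteq> 0"
  using sin_zero_abs_cos_one by (force simp: chord_direction_def zero_prod_def)

lemma polygon_chord:
  assumes "n > 0"
  shows "polygon_point n k - polygon_point n j =
    (2 * sin (pi * (real k - real j) / n)) *\<^sub>R chord_direction n (j + k)"
proof -
  have "2 * pi * k / n = pi * real (j + k) / n + pi * (real k - real j) / n"
    "2 * pi * j / n = pi * real (j + k) / n - pi * (real k - real j) / n"
    using assms by (simp_all add: field_simps)
  then show ?thesis
    unfolding polygon_point_def chord_direction_def
    by (simp add: cos_add sin_add cos_diff sin_diff)
qed

lemma slope_chord_direction_mod:
  assumes "n > 0"
  shows "slope 0 (chord_direction n (s mod n)) = slope 0 (chord_direction n s)"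
proof (rule slope_parallel[symmetric])
  let ?q = "s div n" and ?x = "pi * real (s mod n) / n"
  have "real s = real (s mod n) + real n * real ?q"
    by (metis mod_mult_div_eq of_nat_add of_nat_mult)
  then have "pi * s / n = ?x + real ?q * pi"
    using assms by (simp add: field_simps)
  then show "chord_direction n s - 0 = (- 1) ^ ?q *\<^sub>R (chord_direction n (s mod n) - 0)"
    by (simp add: chord_direction_def sin_add cos_add)
qed (use chord_direction_neq_0 in auto)

lemma slope_polygon_points:
  assumes "j < n" "k < n" "j \<noteq> k"
  shows "slope (polygon_point n j) (polygon_point n k) =
    slope 0 (chord_direction n ((j + k) mod n))"
proof -
  let ?d = "2 * sin (pi * (real k - real j) / n)"
  have chord: "polygon_point n k - polygon_point n j = ?d *\<^sub>R chord_direction n (j + k)"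
    using assms(1) by (intro polygon_chord) simp
  have "polygon_point n j \<noteq> polygon_point n k"
    using inj_onD[OF inj_on_polygon_point] assms by blast
  then have "?d \<noteq> 0" using chord by auto
  then have "slope (polygon_point n j) (polygon_point n k) = slope 0 (chord_direction n (j + k))"
    using chord chord_direction_neq_0[of n "j + k"] by (intro slope_parallel[of _ _ ?d]) auto
  then show ?thesis using slope_chord_direction_mod assms(1) by simp
qed

lemma unobstructed_sphere:
  fixes A B :: "'a::euclidean_space set"
  assumes "A \<union> B \<subseteq> sphere z r"
  shows "unobstructed A B"
proof (rule unobstructedI, rule ccontr)
  fix p q w
  assume pqw: "p \<in> A" "q \<in> B" "w \<in> A \<union> B" "w \<in> closed_segment p q" "\<not> (w = p \<or> w = q)"
  then have "dist z w < dist z p \<or> dist z w < dist z q"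
    by (intro dist_decreases_open_segment) (auto simp: open_segment_def)
  moreover have "dist z p = r" "dist z q = r" "dist z w = r" using pqw assms by auto
  ultimately show False by simp
qed

fun alternating_drawing :: "nat \<Rightarrow> nat + nat \<Rightarrow> real \<times> real" where
  "alternating_drawing b (Inl i) = polygon_point (2 * b) (2 * i)"
| "alternating_drawing b (Inr j) = polygon_point (2 * b) (2 * j + 1)"

lemma is_drawing_alternating_drawing:
  assumes "a \<le> b"
  shows "is_drawing (K_verts a b) (K_edges a b) (alternating_drawing b)"
  unfolding is_drawing_K_iff
proof
  define f where "f = case_sum (\<lambda>i. 2 * i) (\<lambda>j. Suc (2 * j))"
  have "alternating_drawing b = polygon_point (2 * b) \<circ> f"
    by (simp add: fun_eq_iff f_def split: sum.split)
  moreover have "inj_on f (K_verts a b)"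
    by (auto simp: inj_on_def f_def Suc_double_not_eq_double double_not_eq_Suc_double split: sum.splits)
  moreover have "f ` K_verts a b \<subseteq> {..<2 * b}"
    using assms by (auto simp: K_verts_def f_def)
  ultimately show "inj_on (alternating_drawing b) (K_verts a b)"
    using inj_on_polygon_point by (metis comp_inj_on inj_on_subset)
  show "unobstructed (alternating_drawing b ` Inl ` {..<a}) (alternating_drawing b ` Inr ` {..<b})"
    by (rule unobstructed_sphere[where z = 0 and r = 1]) (auto simp: norm_polygon_point)
qed

lemma slope_number_K_le:
  assumes "a \<le> b"
  shows "slope_number (K_verts a b) (K_edges a b) \<le> b"
proof -
  let ?s = "\<lambda>k. slope 0 (chord_direction (2 * b) (2 * k + 1))"
  have "slope (polygon_point (2 * b) (2 * i)) (polygon_point (2 * b) (2 * j + 1)) \<in> ?s ` {..<b}"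
    if ij: "i < a" "j < b" for i j
  proof -
    have "(2 * (i + j) + 1) mod (2 * b) = 2 * ((i + j) mod b) + 1"
      using mod_mult2_eq[of "2 * (i + j) + 1" 2 b] by simp
    then have "(2 * i + (2 * j + 1)) mod (2 * b) = 2 * ((i + j) mod b) + 1"
      by (simp add: algebra_simps)
    then have "slope (polygon_point (2 * b) (2 * i)) (polygon_point (2 * b) (2 * j + 1))
        = ?s ((i + j) mod b)"
      using ij assms by (subst slope_polygon_points) (auto simp: double_not_eq_Suc_double)
    moreover have "(i + j) mod b < b" using ij by simp
    ultimately show ?thesis by blast
  qed
  then have "slopes (K_edges a b) (alternating_drawing b) \<subseteq> ?s ` {..<b}"
    by (auto simp: slopes_K_edges slopes_between_def)
  then have "card (slopes (K_edges a b) (alternating_drawing b)) \<le> b"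
    using surj_card_le[of "{..<b}"] by simp
  with slope_number_le[OF is_drawing_alternating_drawing[OF assms]] show ?thesis by linarith
qed

lemma unobstructed_three_lines:
  fixes A B :: "(real \<times> real) set"
  assumes centre: "\<And>p. p \<in> A \<Longrightarrow> fst p = 0" and sides: "\<And>q. q \<in> B \<Longrightarrow> \<bar>fst q\<bar> = 1"
  shows "unobstructed A B"
proof (rule unobstructedI)
  fix p q w assume pqw: "p \<in> A" "q \<in> B" "w \<in> A \<union> B" "w \<in> closed_segment p q"
  then obtain t where "0 \<le> t" and w_eq: "w = (1 - t) *\<^sub>R p + t *\<^sub>R q"
    by (auto simp: closed_segment_def)
  have "\<bar>fst w\<bar> = t"
    using centre[OF pqw(1)] sides[OF pqw(2)] \<open>0 \<le> t\<close> by (simp add: w_eq abs_mult)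
  moreover have "\<bar>fst w\<bar> = 0 \<or> \<bar>fst w\<bar> = 1" using centre[of w] sides[of w] pqw(3) by auto
  ultimately show "w = p \<or> w = q" using w_eq by auto
qed

text \<open>
  The heights on the line \<open>x = 1\<close> are shifted by \<open>a - k\<close> so that the gradients on both sides range
  over the same integers \<open>1 - k, \<dots>, a - 1\<close>.
\<close>

fun three_line_drawing :: "nat \<Rightarrow> nat \<Rightarrow> nat + nat \<Rightarrow> real \<times> real" where
  "three_line_drawing a k (Inl i) = (0, real i)"
| "three_line_drawing a k (Inr j) =
     (if j < k then (- 1, real j) else (1, real (j - k) + real a - real k))"

lemma is_drawing_three_line_drawing:
  "is_drawing (K_verts a b) (K_edges a b) (three_line_drawing c k)"
  unfolding is_drawing_K_iff
proof
  show "inj_on (three_line_drawing c k) (K_verts a b)"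
    by (auto simp: inj_on_def K_verts_def split: if_splits)
  show "unobstructed (three_line_drawing c k ` Inl ` {..<a}) (three_line_drawing c k ` Inr ` {..<b})"
    by (rule unobstructed_three_lines) auto
qed

lemma slope_number_K_le_three_lines:
  assumes "1 \<le> a" "b \<le> 2 * k"
  shows "slope_number (K_verts a b) (K_edges a b) \<le> k + a - 1"
proof -
  let ?I = "{1 - int k..int a - 1}" and ?s = "\<lambda>m. slope (0, 0) (1, real_of_int m)"
  have "slope (three_line_drawing a k (Inl i)) (three_line_drawing a k (Inr j)) \<in> ?s ` ?I"
    if ij: "i < a" "j < b" for i j
  proof (cases "j < k")
    case True
    let ?m = "int i - int j"
    have "slope (0, real i) (- 1, real j) = ?s ?m"
      by (rule slope_parallel[where d = "- 1"]) auto
    moreover have "?m \<in> ?I" using True ij by auto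
    ultimately show ?thesis using True imageI[of ?m ?I ?s] by simp
  next
    case False
    let ?m = "int (j - k) + int a - int k - int i"
    have "slope (0, real i) (1, real (j - k) + real a - real k) = ?s ?m"
      by (rule slope_parallel[where d = 1]) auto
    moreover have "?m \<in> ?I" using False ij assms by auto
    ultimately show ?thesis using False imageI[of ?m ?I ?s] by simp
  qed
  then have "slopes (K_edges a b) (three_line_drawing a k) \<subseteq> ?s ` ?I"
    by (auto simp: slopes_K_edges slopes_between_def simp del: three_line_drawing.simps)
  then have "card (slopes (K_edges a b) (three_line_drawing a k)) \<le> card ?I"
    by (rule surj_card_le[rotated]) simp
  also have "card ?I = k + a - 1" using assms by simp
  finally show ?thesis
    using slope_number_le[OF is_drawing_three_line_drawing] le_trans by blast
qed

lemma slope_number_K_ge: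
  assumes "1 \<le> a" "1 \<le> b"
  shows "a + b \<le> Suc (2 * slope_number (K_verts a b) (K_edges a b))"
  using slope_number_attained[OF is_drawing_three_line_drawing] card_slopes_K_ge[OF assms] by metis

theorem theorem2:
  fixes a b :: nat
  assumes "1 \<le> a" and "a \<le> b"
  shows "(1 / 2) * (real a + real b - 1) \<le> real (slope_number (K_verts a b) (K_edges a b))
       \<and> int (slope_number (K_verts a b) (K_edges a b))
           \<le> min (int b) (\<lceil>real b / 2\<rceil> + int a - 1)"
proof -
  let ?sn = "slope_number (K_verts a b) (K_edges a b)"
  have lower: "a + b \<le> Suc (2 * ?sn)"
    using assms by (intro slope_number_K_ge) simp_all
  define k where "k = nat \<lceil>real b / 2\<rceil>"
  have int_k: "int k = \<lceil>real b / 2\<rceil>" by (simp add: k_def)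
  then have "b \<le> 2 * k" by linarith
  with assms(1) have "?sn \<le> k + a - 1" by (rule slope_number_K_le_three_lines)
  then have "int ?sn \<le> \<lceil>real b / 2\<rceil> + int a - 1"
    using int_k assms(1) by linarith
  with lower slope_number_K_le[OF assms(2)] show ?thesis by auto
qed

end
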